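(* Let $K$ be an abstract simplicial complex with a fixed base vertex $v_0$. Then $\mathrm{scat}\,K\leq\mathrm{scat}^{\mathrm{Wh}}K$.
   Context: Two simplicial maps $\varphi,\psi\colon K\to L$ between abstract simplicial complexes are contiguous, $\varphi\sim_c\psi$, if for every simplex $\sigma$ of $K$ the set of vertices $\varphi(\sigma)\cup\psi(\sigma)$ is a simplex of $L$. They are in the same contiguity class, $\varphi\sim\psi$, if there is a finite sequence of simplicial maps $\varphi=\varphi_1\sim_c\varphi_2\sim_c\cdots\sim_c\varphi_m=\psi$ from $K$ to $L$. A subcomplex $U\subset K$ is categorical (in $K$) if there is a vertex $v\in K$ such that the inclusion $U\to K$ and the constant map $c_v\colon U\to K$ with value $v$ are in the same contiguity class. The simplicial LS-category $\mathrm{scat}\, K$ is the least integer $n\geq 0$ such that $K=U_0\cup\cdots\cup U_n$ for some $n+1$ categorical subcomplexes $U_0,\dots,U_n$ of $K$ ($\infty$ if there is none). The categorical product $K\times L$ of abstract simplicial complexes has as vertices the pairs $(v,w)$ of a vertex $v$ of $K$ and a vertex $w$ of $L$; a finite nonempty set $\{(v_1,w_1),\dots,(v_q,w_q)\}$ is a simplex iff $\{v_1,\dots,v_q\}$ is a simplex of $K$ and $\{w_1,\dots,w_q\}$ is a simplex of $L$. $K^n$ is the $n$-fold categorical product, with projections $\pi_j\colon K^n\to K$, and $\Delta\colon K\to K^n$, $\Delta(v)=(v,\dots,v)$, is the diagonal map, which is simplicial. For $n\geq1$ and $j=1,\dots,n$ let $K_j=\pi_j^{-1}(\{v_0\})$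 be the (full) subcomplex of $K^n$ spanned by the vertices whose $j$-th coordinate is $v_0$. The $n$-th fat wedge is the subcomplex $T^nK=K_1\cup\cdots\cup K_n\subset K^n$. We say $\mathrm{scat}^{\mathrm{Wh}}K\leq n$ if there is a simplicial map $\delta\colon K\to T^{n+1}K$ such that $I\circ\delta\sim\Delta$, where $I\colon T^{n+1}K\subset K^{n+1}$ is the inclusion and $\Delta\colon K\to K^{n+1}$ is the diagonal (contiguity class as unpointed maps). $\mathrm{scat}^{\mathrm{Wh}}K$, the simplicial Whitehead category, is the least such $n\ge 0$ ($\infty$ if there is none). *)

theory Defs
  imports Main "HOL-Library.Extended_Nat"
begin

text \<open>
  A complex is represented by its set of simplices. The empty set is never a simplex,
  and the vertices are the points occurring in some simplex.
\<close>

definition abstract_complex :: "'a set set \<Rightarrow> bool" where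
  "abstract_complex K \<longleftrightarrow>
     (\<forall>\<sigma>\<in>K. finite \<sigma> \<and> \<sigma> \<noteq> {} \<and> (\<forall>\<tau>. \<tau> \<subseteq> \<sigma> \<and> \<tau> \<noteq> {} \<longrightarrow> \<tau> \<in> K))"

definition vertices :: "'a set set \<Rightarrow> 'a set" where
  "vertices K = \<Union>K"

definition subcomplex :: "'a set set \<Rightarrow> 'a set set \<Rightarrow> bool" where
  "subcomplex U K \<longleftrightarrow> abstract_complex U \<and> U \<subseteq> K"

text \<open>
  A map of complexes is a total function of which only the values on vertices matter.
\<close>

definition simplicial_map :: "'a set set \<Rightarrow> 'b set set \<Rightarrow> ('a \<Rightarrow> 'b) \<Rightarrow> bool" where
  "simplicial_map K L f \<longleftrightarrow> (\<forall>\<sigma>\<in>K. f ` \<sigma> \<in> L)"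

definition contiguous :: "'a set set \<Rightarrow> 'b set set \<Rightarrow> ('a \<Rightarrow> 'b) \<Rightarrow> ('a \<Rightarrow> 'b) \<Rightarrow> bool" where
  "contiguous K L f g \<longleftrightarrow> simplicial_map K L f \<and> simplicial_map K L g \<and>
     (\<forall>\<sigma>\<in>K. f ` \<sigma> \<union> g ` \<sigma> \<in> L)"

text \<open>
  Simplicial maps that agree on the vertices are contiguous, so the relation below does not
  depend on the values off the vertices, even though chains compare total functions.
\<close>

definition same_contiguity_class ::
    "'a set set \<Rightarrow> 'b set set \<Rightarrow> ('a \<Rightarrow> 'b) \<Rightarrow> ('a \<Rightarrow> 'b) \<Rightarrow> bool" where
  "same_contiguity_class K L f g \<longleftrightarrow>
     simplicial_map K L f \<and> simplicial_map K L g \<and> (contiguous K L)\<^sup>*\<^sup>* f g"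

lemma contiguous_if_eq_on_vertices:
  assumes "simplicial_map K L f" and "\<And>v. v \<in> vertices K \<Longrightarrow> f v = g v"
  shows "contiguous K L f g"
proof -
  have "g ` \<sigma> = f ` \<sigma>" if "\<sigma> \<in> K" for \<sigma>
    using assms(2) that by (force simp: vertices_def)
  then show ?thesis
    using assms(1) by (simp add: contiguous_def simplicial_map_def)
qed

definition categorical :: "'a set set \<Rightarrow> 'a set set \<Rightarrow> bool" where
  "categorical K U \<longleftrightarrow> subcomplex U K \<and>
     (\<exists>v\<in>vertices K. same_contiguity_class U K id (\<lambda>_. v))"

definition scat :: "'a set set \<Rightarrow> enat" where
  "scat K = Inf {enat n | n. \<exists>U :: nat \<Rightarrow> 'a set set.
     (\<forall>i\<le>n. categorical K (U i)) \<and> K = (\<Union>i\<le>n. U i)}"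

definition cat_prod :: "'a set set \<Rightarrow> 'b set set \<Rightarrow> ('a \<times> 'b) set set" where
  "cat_prod K L = {S. finite S \<and> S \<noteq> {} \<and> fst ` S \<in> K \<and> snd ` S \<in> L}"

text \<open>
  Vertices of the \<open>n\<close>-fold product are lists of length \<open>n\<close>, with coordinates numbered from 0.
  The lemmas below identify this with the iterated binary product.
\<close>

definition cat_power :: "'a set set \<Rightarrow> nat \<Rightarrow> 'a list set set" where
  "cat_power K n = {S. finite S \<and> S \<noteq> {} \<and> (\<forall>xs\<in>S. length xs = n) \<and>
     (\<forall>j<n. (\<lambda>xs. xs ! j) ` S \<in> K)}"

lemma cat_power_1:
  assumes "abstract_complex K"
  shows "cat_power K 1 = (\<lambda>\<sigma>. (\<lambda>x. [x]) ` \<sigma>) ` K"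
proof (intro equalityI subsetI)
  fix S assume S: "S \<in> cat_power K 1"
  have "[xs ! 0] = xs" if "xs \<in> S" for xs
    using S that by (cases xs) (auto simp: cat_power_def)
  then have "(\<lambda>x. [x]) ` (\<lambda>xs. xs ! 0) ` S = S"
    unfolding image_image by simp
  moreover have "(\<lambda>xs. xs ! 0) ` S \<in> K"
    using S by (simp add: cat_power_def)
  ultimately show "S \<in> (\<lambda>\<sigma>. (\<lambda>x. [x]) ` \<sigma>) ` K"
    by (intro image_eqI[where x = "(\<lambda>xs. xs ! 0) ` S"]) simp_all
next
  fix S assume "S \<in> (\<lambda>\<sigma>. (\<lambda>x. [x]) ` \<sigma>) ` K"
  then obtain \<sigma> where \<sigma>: "\<sigma> \<in> K" "S = (\<lambda>x. [x]) ` \<sigma>" by blast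
  have "finite \<sigma>" "\<sigma> \<noteq> {}"
    using assms \<sigma>(1) by (simp_all add: abstract_complex_def)
  then show "S \<in> cat_power K 1"
    using \<sigma> by (simp add: cat_power_def image_image)
qed

lemma cat_power_Suc:
  "cat_power K (Suc n) =
    (\<lambda>S. (\<lambda>(x, xs). x # xs) ` S) ` cat_prod K (cat_power K n)"
proof (intro equalityI subsetI)
  fix S assume S: "S \<in> cat_power K (Suc n)"
  define T where "T = (\<lambda>xs. (hd xs, tl xs)) ` S"
  have ne: "xs \<noteq> []" if "xs \<in> S" for xs
    using S that by (auto simp: cat_power_def)
  have "(\<lambda>(x, xs). x # xs) ` T = S"
    using ne by (simp add: T_def image_image)
  moreover have "fst ` T = (\<lambda>xs. xs ! 0) ` S"
    unfolding T_def image_image by (rule image_cong) (auto simp: hd_conv_nth ne)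
  moreover have "(\<lambda>xs. xs ! j) ` snd ` T = (\<lambda>xs. xs ! Suc j) ` S" for j
    unfolding T_def image_image 
    by (rule image_cong) (auto dest!: ne simp: neq_Nil_conv)
  moreover have "finite T" "T \<noteq> {}" "\<forall>xs\<in>snd ` T. length xs = n"
    using S by (auto simp: cat_power_def T_def)
  ultimately show "S \<in> (\<lambda>S. (\<lambda>(x, xs). x # xs) ` S) ` cat_prod K (cat_power K n)"
    using S by (intro image_eqI[where x = T]) (simp_all add: cat_power_def cat_prod_def)
next
  fix S assume "S \<in> (\<lambda>S. (\<lambda>(x, xs). x # xs) ` S) ` cat_prod K (cat_power K n)"
  then obtain T where T: "T \<in> cat_prod K (cat_power K n)" "S = (\<lambda>(x, xs). x # xs) ` T"
    by blast
  have "(\<lambda>xs. xs ! j) ` S \<in> K" if "j < Suc n" for j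
  proof (cases j)
    case 0
    then have "(\<lambda>xs. xs ! j) ` S = fst ` T"
      unfolding T(2) image_image by (intro image_cong) auto
    then show ?thesis using T by (simp add: cat_prod_def)
  next
    case (Suc i)
    then have "(\<lambda>xs. xs ! j) ` S = (\<lambda>xs. xs ! i) ` snd ` T"
      unfolding T(2) image_image by (intro image_cong) auto
    then show ?thesis using T that Suc by (simp add: cat_prod_def cat_power_def)
  qed
  moreover have "finite S" "S \<noteq> {}" "\<forall>xs\<in>S. length xs = Suc n"
    using T by (auto simp: cat_prod_def cat_power_def)
  ultimately show "S \<in> cat_power K (Suc n)"
    by (simp add: cat_power_def)
qed

definition diagonal :: "nat \<Rightarrow> 'a \<Rightarrow> 'a list" where
  "diagonal n v = replicate n v"

definition wedge_part :: "'a set set \<Rightarrow> 'a \<Rightarrow> nat \<Rightarrow> nat \<Rightarrow> 'a list set set" where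
  "wedge_part K v\<^sub>0 n j = {S \<in> cat_power K n. \<forall>xs\<in>S. xs ! j = v\<^sub>0}"

definition fat_wedge :: "'a set set \<Rightarrow> 'a \<Rightarrow> nat \<Rightarrow> 'a list set set" where
  "fat_wedge K v\<^sub>0 n = (\<Union>j<n. wedge_part K v\<^sub>0 n j)"

definition scat_Wh :: "'a set set \<Rightarrow> 'a \<Rightarrow> enat" where
  "scat_Wh K v\<^sub>0 = Inf {enat n | n. \<exists>\<delta>. simplicial_map K (fat_wedge K v\<^sub>0 (n + 1)) \<delta> \<and>
     same_contiguity_class K (cat_power K (n + 1)) (id \<circ> \<delta>) (diagonal (n + 1))}"

end

theory Submission imports Defs begin

text \<open>
  Given \<open>\<delta>\<close>, let \<open>U\<^sub>j\<close> be the preimage under \<open>\<delta>\<close> of the \<open>j\<close>-th part of the fat wedge. Composing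
  a chain from \<open>\<delta>\<close> to the diagonal with the \<open>j\<close>-th projection and restricting it to \<open>U\<^sub>j\<close> joins the
  constant map with value \<open>v\<^sub>0\<close> to the inclusion of \<open>U\<^sub>j\<close>.
\<close>

lemma contiguous_commute: "contiguous K L f g \<Longrightarrow> contiguous K L g f"
  by (auto simp: contiguous_def Un_commute)

lemma same_contiguity_class_commute:
  assumes "same_contiguity_class K L f g"
  shows "same_contiguity_class K L g f"
proof -
  have "symp (contiguous K L)"
    by (auto intro: sympI contiguous_commute)
  then show ?thesis
    using assms sympD[OF symp_rtranclp] unfolding same_contiguity_class_def by fast
qed

lemma simplicial_map_comp:
  "simplicial_map K L f \<Longrightarrow> simplicial_map L M h \<Longrightarrow> simplicial_map K M (h \<circ> f)"
  unfolding simplicial_map_def image_comp[symmetric] by blast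

lemma contiguous_comp:
  assumes "contiguous K L f g" and "simplicial_map L M h"
  shows "contiguous K M (h \<circ> f) (h \<circ> g)"
  using assms simplicial_map_comp[OF _ assms(2)]
  unfolding contiguous_def simplicial_map_def[of L] image_comp[symmetric] image_Un[symmetric]
  by blast

text \<open>Since \<open>h\<close> is simplicial, it sends a chain of contiguous maps to such a
  chain, link by link.\<close>

lemma same_contiguity_class_comp:
  assumes "same_contiguity_class K L f g" and "simplicial_map L M h"
  shows "same_contiguity_class K M (h \<circ> f) (h \<circ> g)"
proof -
  have "(contiguous K L)\<^sup>*\<^sup>* f g"
    using assms(1) by (simp add: same_contiguity_class_def)
  then have "(contiguous K M)\<^sup>*\<^sup>* (h \<circ> f) (h \<circ> g)"
    by induction (blast intro: rtranclp.rtrancl_into_rtrancl contiguous_comp[OF _ assms(2)])+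
  then show ?thesis
    using assms simplicial_map_comp unfolding same_contiguity_class_def by blast
qed

text \<open>Contiguity is tested one simplex at a time, so a chain over \<open>K\<close> serves
  unchanged over any smaller family of simplices.\<close>

lemma same_contiguity_class_mono:
  assumes "same_contiguity_class K L f g" and "U \<subseteq> K"
  shows "same_contiguity_class U L f g"
proof -
  have "contiguous K L \<le> contiguous U L"
    using assms(2) unfolding contiguous_def simplicial_map_def by blast
  then have "(contiguous K L)\<^sup>*\<^sup>* \<le> (contiguous U L)\<^sup>*\<^sup>*"
    by (rule rtranclp_mono)
  then show ?thesis
    using assms unfolding same_contiguity_class_def simplicial_map_def by blast
qed

text \<open>Chains compare total functions, so replacing \<open>f\<close> by a map with other values
  off the vertices costs one more link, put in front of the chain.\<close>

lemma same_contiguity_class_cong_left: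
  assumes "same_contiguity_class K L f g" and "\<And>v. v \<in> vertices K \<Longrightarrow> f v = f' v"
  shows "same_contiguity_class K L f' g"
proof -
  have "contiguous K L f f'"
    using assms by (intro contiguous_if_eq_on_vertices) (simp_all add: same_contiguity_class_def)
  then have "contiguous K L f' f"
    by (rule contiguous_commute)
  then show ?thesis
    using assms(1) unfolding same_contiguity_class_def
    by (meson contiguous_def converse_rtranclp_into_rtranclp)
qed

lemma simplicial_map_nth:
  "j < n \<Longrightarrow> simplicial_map (cat_power K n) K (\<lambda>xs. xs ! j)"
  by (simp add: simplicial_map_def cat_power_def)

lemma abstract_complex_cat_power:
  assumes "abstract_complex K"
  shows "abstract_complex (cat_power K n)"
  unfolding abstract_complex_def
proof (intro ballI conjI allI impI)
  fix S T assume S: "S \<in> cat_power K n" and T: "T \<subseteq> S \<and> T \<noteq> {}"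
  have "(\<lambda>xs. xs ! j) ` T \<in> K" if "j < n" for j
  proof -
    have "(\<lambda>xs. xs ! j) ` S \<in> K"
      using S that by (simp add: cat_power_def)
    moreover have "(\<lambda>xs. xs ! j) ` T \<subseteq> (\<lambda>xs. xs ! j) ` S" "(\<lambda>xs. xs ! j) ` T \<noteq> {}"
      using T by auto
    ultimately show ?thesis
      using assms unfolding abstract_complex_def by blast
  qed
  then show "T \<in> cat_power K n"
    using S T finite_subset[of T S] unfolding cat_power_def by blast
qed (auto simp: cat_power_def)

lemma abstract_complex_wedge_part:
  assumes "abstract_complex K"
  shows "abstract_complex (wedge_part K v\<^sub>0 n j)"
  using abstract_complex_cat_power[OF assms, of n]
  unfolding abstract_complex_def wedge_part_def by blast

text \<open>The image of a nonempty face is a nonempty subset of the image of the simplex, so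
  membership in \<open>L\<close> passes to faces.\<close>

lemma subcomplex_preimage:
  assumes "abstract_complex K" and "abstract_complex L"
  shows "subcomplex {\<sigma> \<in> K. f ` \<sigma> \<in> L} K"
proof -
  have "f ` \<tau> \<in> L" if "f ` \<sigma> \<in> L" "\<tau> \<subseteq> \<sigma>" "\<tau> \<noteq> {}" for \<sigma> \<tau>
    using assms(2) that image_mono[of \<tau> \<sigma> f]
    unfolding abstract_complex_def by blast
  then show ?thesis
    using assms(1) unfolding subcomplex_def abstract_complex_def by blast
qed

lemma categorical_preimage_wedge_part:
  assumes "abstract_complex K" and "v\<^sub>0 \<in> vertices K" and "j < n"
    and "same_contiguity_class K (cat_power K n) \<delta> (diagonal n)"
  shows "categorical K {\<sigma> \<in> K. \<delta> ` \<sigma> \<in> wedge_part K v\<^sub>0 n j}"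
proof -
  define U where "U = {\<sigma> \<in> K. \<delta> ` \<sigma> \<in> wedge_part K v\<^sub>0 n j}"
  have sub: "subcomplex U K"
    unfolding U_def by (intro subcomplex_preimage abstract_complex_wedge_part assms(1))
  then have "same_contiguity_class U (cat_power K n) \<delta> (diagonal n)"
    using same_contiguity_class_mono[OF assms(4)] by (simp add: subcomplex_def)
  then have "same_contiguity_class U K ((\<lambda>xs. xs ! j) \<circ> \<delta>) ((\<lambda>xs. xs ! j) \<circ> diagonal n)"
    using simplicial_map_nth[OF assms(3)] by (rule same_contiguity_class_comp)
  also have "(\<lambda>xs. xs ! j) \<circ> diagonal n = id"
    using assms(3) by (auto simp: diagonal_def)
  finally have "same_contiguity_class U K ((\<lambda>xs. xs ! j) \<circ> \<delta>) id" .
  \<comment> \<open>The projection of \<open>\<delta>\<close> is constant only on the vertices of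
    \<open>U\<close>; elsewhere its values are arbitrary, so it cannot simply be rewritten to the
    constant function.\<close>
  moreover have "((\<lambda>xs. xs ! j) \<circ> \<delta>) v = v\<^sub>0" if "v \<in> vertices U" for v
    using that by (auto simp: U_def vertices_def wedge_part_def)
  ultimately have "same_contiguity_class U K (\<lambda>_. v\<^sub>0) id"
    by (rule same_contiguity_class_cong_left)
  \<comment> \<open>The chain runs from the constant map to the inclusion and has to be reversed for
    \<open>categorical\<close>.\<close>
  then show ?thesis
    using sub assms(2) unfolding categorical_def U_def
    by (blast intro: same_contiguity_class_commute)
qed

theorem theorem6p2p2:
  fixes K :: "'a set set" and v\<^sub>0 :: 'a
  assumes "abstract_complex K" and "v\<^sub>0 \<in> vertices K"
  shows "scat K \<le> scat_Wh K v\<^sub>0"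
  unfolding scat_def scat_Wh_def
\<comment> \<open>It suffices that every \<open>n\<close> admissible for \<open>scat_Wh\<close> is
  admissible for \<open>scat\<close>. If there is no such \<open>n\<close>, the right-hand side is
  infinite.\<close>
proof (rule Inf_superset_mono, clarify)
  fix n \<delta>
  assume simp: "simplicial_map K (fat_wedge K v\<^sub>0 (n + 1)) \<delta>"
    and same: "same_contiguity_class K (cat_power K (n + 1)) (id \<circ> \<delta>) (diagonal (n + 1))"
  define U where "U j = {\<sigma> \<in> K. \<delta> ` \<sigma> \<in> wedge_part K v\<^sub>0 (n + 1) j}" for j
  have "categorical K (U j)" if "j \<le> n" for j
    unfolding U_def using same that
    by (intro categorical_preimage_wedge_part assms) simp_all
  \<comment> \<open>The image of each simplex under \<open>\<delta>\<close> lies in a single part of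
    the fat wedge. The \<open>n + 1\<close> parts are numbered from 0 to \<open>n\<close>, matching
    the index range in \<open>scat\<close>.\<close>
  moreover have "K = (\<Union>j\<le>n. U j)"
    using simp by (fastforce simp: simplicial_map_def fat_wedge_def U_def less_Suc_eq_le)
  ultimately show "\<exists>m. enat n = enat m \<and>
      (\<exists>U :: nat \<Rightarrow> 'a set set. (\<forall>i\<le>m. categorical K (U i)) \<and> K = (\<Union>i\<le>m. U i))"
    by blast
qed

end
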